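(* Let $H=\langle m_0,\dots,m_p,n\rangle$ be a numerical semigroup minimally generated by an almost arithmetic sequence, with associated data as in the context, and assume $W\ne\emptyset$. Suppose $r\ge2$. Then for each $\beta_j\in\mathrm{PF}_2(H)$, $j\in[p-r+2,p]$, letting $e\in[1,p-1]$ be defined by $r+j+e=2p+1$, there exists an $\mathrm{RF}$-matrix for $\beta_j$ whose rows (indexed by $0,1,\dots,p,n$) are: (1) row $0$: $-E_0+qE_p+(v-w-1)E_n+E_{p-e}$; (2) row $k$ for $k\in[1,e]$: $-E_k+qE_p+(v-w-1)E_n+E_{p-e+k}$; (3) row $k$ for $k\in[e+1,p]$: $(\lambda-1)E_0-E_k+(v-1)E_n+E_{j+k-p-1}$; (4) row $n$: $(\nu-\epsilon)E_0+q_{z+j-p-1}E_p-E_n+E_{r_{z+j-p-1}}$, where $\epsilon=2$ if $r'+r_{z+j-p-1}\le p$ and $\epsilon=1$ if $r'+r_{z+j-p-1}>p$.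
   Context: Notation: $\mathbb N=\{0,1,2,\dots\}$; $[a,b]$ is the set of integers $i$ with $a\le i\le b$. Let $p\ge1$, $d\ge1$, $m_0\ge 1$ be integers, $m_i=m_0+id$ for $i\in[0,p]$, and $n\ge1$ an integer with $\gcd(m_0,d,n)=1$. Put $H'=\sum_{i=0}^p\mathbb Nm_i$ and $H=H'+\mathbb Nn=\langle m_0,\dots,m_p,n\rangle$; assume $\{m_0,\dots,m_p,n\}$ is a minimal generating set of $H$. $\mathrm{Ap}(H,m_0)=\{h\in H: h-m_0\notin H\}$. For $t\in\mathbb N$ write $t=q_tp+r_t$ with $q_t\in\mathbb Z$, $r_t\in[1,p]$, and set $g_t=q_tm_p+m_{r_t}$ (so $q_0=-1$, $r_0=p$, $g_0=0$). Let $u=\min\{t\in\mathbb N: g_t\notin\mathrm{Ap}(H,m_0)\}$ and $v=\min\{b\ge1: bn\in H'\}$. It is known (Patil–Singh) that there are unique integers $z\in[0,u-1]$, $w\in[0,v-1]$, $\lambda\ge1$, $\mu\ge0$ with $g_u=\lambda m_0+wn$, $vn=\mu m_0+g_z$, and $g_{u-z}+(v-w)n=\nu m_0$, where $\nu=\lambda+\mu+1$ if $r_{u-z}<r_u$ and $\nu=\lambda+\mu$ if $r_{u-z}\ge r_u$. Set $r=r_u$, $q=q_u$, $r'=r_{u-z}$, $q'=q_{u-z}$, and $W=[u-z,u-1]\times[v-w,v-1]$ (empty iff $z=0$ or $w=0$). $\mathrm{PF}(H)$ is the set of $f\in\mathbb Z\setminus H$ with $f+h\in H$ for all $h\in H\setminus\{0\}$.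 An $\mathrm{RF}$-matrix for $f\in\mathrm{PF}(H)$ is a $(p+2)\times(p+2)$ integer matrix with rows and columns indexed by $0,1,\dots,p,n$ (corresponding to the generators $m_0,\dots,m_p,n$), with all diagonal entries $-1$, all off-diagonal entries in $\mathbb N$, and such that each row $(b_0,\dots,b_p,b_n)$ satisfies $\sum_{j=0}^p b_jm_j+b_nn=f$. $E_0,\dots,E_p,E_n$ denote the standard basis vectors of $\mathbb Z^{p+2}$ (coordinates indexed by $0,\dots,p,n$). When $W\neq\emptyset$, let $\beta_j=g_{(q-1)p+r+j-1}+(v-w-1)n-m_0$ for $j\in[1,p]$. $\mathrm{PF}_2(H)$ denotes the set of pseudo-Frobenius numbers of $H$ of the form $\beta_j$ with $j\in[1,p]$ if $r=1$, and with $j\in[p-r+2,p]$ if $r\ge2$. *)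

theory Defs
  imports "Jordan_Normal_Form.Matrix"
begin

text \<open>Only meaningful for finite \<open>S\<close>: the sum over an infinite set is \<open>0\<close>.\<close>

definition nat_span :: "int set \<Rightarrow> int set" where
  "nat_span S = {\<Sum>x\<in>S. int (c x) * x | c :: int \<Rightarrow> nat. True}"

definition minimal_generating_set :: "int set \<Rightarrow> int set \<Rightarrow> bool" where
  "minimal_generating_set S K \<longleftrightarrow> nat_span S = K \<and> (\<forall>T. T \<subset> S \<longrightarrow> nat_span T \<noteq> K)"

definition apery :: "int set \<Rightarrow> int \<Rightarrow> int set" where
  "apery K a = {h \<in> K. h - a \<notin> K}"

definition pseudo_frobenius :: "int set \<Rightarrow> int set" where
  "pseudo_frobenius K = {f. f \<notin> K \<and> (\<forall>h \<in> K - {0}. f + h \<in> K)}"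

definition arith_gen :: "nat \<Rightarrow> nat \<Rightarrow> nat \<Rightarrow> int" where
  "arith_gen d m0 i = int m0 + int i * int d"

definition gens :: "nat \<Rightarrow> nat \<Rightarrow> nat \<Rightarrow> nat \<Rightarrow> int set" where
  "gens p d m0 n = insert (int n) (arith_gen d m0 ` {0..p})"

definition semigroup_H' :: "nat \<Rightarrow> nat \<Rightarrow> nat \<Rightarrow> int set" where
  "semigroup_H' p d m0 = nat_span (arith_gen d m0 ` {0..p})"

definition semigroup_H :: "nat \<Rightarrow> nat \<Rightarrow> nat \<Rightarrow> nat \<Rightarrow> int set" where
  "semigroup_H p d m0 n = nat_span (gens p d m0 n)"

definition almost_arithmetic :: "nat \<Rightarrow> nat \<Rightarrow> nat \<Rightarrow> nat \<Rightarrow> bool" where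
  "almost_arithmetic p d m0 n \<longleftrightarrow>
     p \<ge> 1 \<and> d \<ge> 1 \<and> m0 \<ge> 1 \<and> n \<ge> 1 \<and> gcd m0 (gcd d n) = 1 \<and>
     minimal_generating_set (gens p d m0 n) (semigroup_H p d m0 n)"

text \<open>The pair \<open>(quo p t, rmd p t)\<close> is division with remainder in \<open>{1..p}\<close> instead of
  \<open>{0..<p}\<close>. The argument is an integer so that differences of indices are not truncated.\<close>

definition quo :: "nat \<Rightarrow> int \<Rightarrow> int" where
  "quo p t = (t - 1) div int p"

definition rmd :: "nat \<Rightarrow> int \<Rightarrow> nat" where
  "rmd p t = nat ((t - 1) mod int p) + 1"

lemma quo_rmd:
  assumes "p \<ge> 1"
  shows "t = quo p t * int p + int (rmd p t)" and "rmd p t \<in> {1..p}"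
proof -
  have "(t - 1) mod int p \<ge> 0" and "(t - 1) mod int p < int p"
    using assms by simp_all
  moreover have "t - 1 = (t - 1) div int p * int p + (t - 1) mod int p"
    by simp
  ultimately show "t = quo p t * int p + int (rmd p t)" and "rmd p t \<in> {1..p}"
    unfolding quo_def rmd_def by auto
qed

definition g_elt :: "nat \<Rightarrow> nat \<Rightarrow> nat \<Rightarrow> int \<Rightarrow> int" where
  "g_elt p d m0 t = quo p t * arith_gen d m0 p + arith_gen d m0 (rmd p t)"

definition u_idx :: "nat \<Rightarrow> nat \<Rightarrow> nat \<Rightarrow> nat \<Rightarrow> nat" where
  "u_idx p d m0 n = (LEAST t. g_elt p d m0 (int t) \<notin> apery (semigroup_H p d m0 n) (int m0))"

definition v_idx :: "nat \<Rightarrow> nat \<Rightarrow> nat \<Rightarrow> nat \<Rightarrow> nat" where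
  "v_idx p d m0 n = (LEAST b. b \<ge> 1 \<and> int b * int n \<in> semigroup_H' p d m0)"

definition nu_coeff :: "nat \<Rightarrow> nat \<Rightarrow> nat \<Rightarrow> nat \<Rightarrow> nat \<Rightarrow> nat \<Rightarrow> nat \<Rightarrow> int" where
  "nu_coeff p d m0 n z lam mu =
     (let u = int (u_idx p d m0 n) in
      if rmd p (u - int z) < rmd p u then int lam + int mu + 1 else int lam + int mu)"

text \<open>The relations that determine the Patil--Singh parameters \<open>z, w, lam, mu\<close> of the sequence.\<close>

definition patil_singh_data ::
    "nat \<Rightarrow> nat \<Rightarrow> nat \<Rightarrow> nat \<Rightarrow> nat \<Rightarrow> nat \<Rightarrow> nat \<Rightarrow> nat \<Rightarrow> bool" where
  "patil_singh_data p d m0 n z w lam mu \<longleftrightarrow>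
     (let u = u_idx p d m0 n; v = v_idx p d m0 n; g = g_elt p d m0 in
        z < u \<and> w < v \<and> lam \<ge> 1 \<and>
        g (int u) = int lam * int m0 + int w * int n \<and>
        int v * int n = int mu * int m0 + g (int z) \<and>
        g (int u - int z) + (int v - int w) * int n = nu_coeff p d m0 n z lam mu * int m0)"

definition W_set :: "nat \<Rightarrow> nat \<Rightarrow> nat \<Rightarrow> nat \<Rightarrow> nat \<Rightarrow> nat \<Rightarrow> (int \<times> int) set" where
  "W_set p d m0 n z w =
     (let u = int (u_idx p d m0 n); v = int (v_idx p d m0 n) in
        {u - int z..u - 1} \<times> {v - int w..v - 1})"

definition beta :: "nat \<Rightarrow> nat \<Rightarrow> nat \<Rightarrow> nat \<Rightarrow> nat \<Rightarrow> nat \<Rightarrow> int" where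
  "beta p d m0 n w j =
     (let u = int (u_idx p d m0 n); v = int (v_idx p d m0 n); q = quo p u; r = int (rmd p u) in
        g_elt p d m0 ((q - 1) * int p + r + int j - 1) + (v - int w - 1) * int n - int m0)"

definition PF2 :: "nat \<Rightarrow> nat \<Rightarrow> nat \<Rightarrow> nat \<Rightarrow> nat \<Rightarrow> int set" where
  "PF2 p d m0 n w =
     (let r = rmd p (int (u_idx p d m0 n)) in
        beta p d m0 n w ` (if r = 1 then {1..p} else {p - r + 2..p})
          \<inter> pseudo_frobenius (semigroup_H p d m0 n))"

text \<open>Row and column \<open>i\<close> with \<open>i \<le> p\<close> belong to the generator \<open>m\<^sub>i\<close>; the row and column of the
  generator \<open>n\<close> have index \<open>p + 1\<close>.\<close>

definition RF_matrix :: "nat \<Rightarrow> nat \<Rightarrow> nat \<Rightarrow> nat \<Rightarrow> int \<Rightarrow> int mat \<Rightarrow> bool" where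
  "RF_matrix p d m0 n f A \<longleftrightarrow>
     A \<in> carrier_mat (p + 2) (p + 2) \<and>
     (\<forall>i < p + 2. A $$ (i, i) = -1) \<and>
     (\<forall>i < p + 2. \<forall>j < p + 2. i \<noteq> j \<longrightarrow> A $$ (i, j) \<ge> 0) \<and>
     (\<forall>i < p + 2. (\<Sum>j = 0..p. A $$ (i, j) * arith_gen d m0 j) + A $$ (i, p + 1) * int n = f)"

end

theory Submission
  imports Defs
begin

text \<open>The row sums all follow from the addition rule
  \<open>g\<^sub>x + g\<^sub>y = g\<^bsub>x+y\<^esub> + \<epsilon> m\<^sub>0\<close>, where \<open>\<epsilon> = 1\<close> if \<open>r\<^sub>x + r\<^sub>y \<le> p\<close> and \<open>\<epsilon> = 0\<close> otherwise,
  together with the Patil--Singh relations. Nonnegativity is delicate only in the last row, where it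
  needs \<open>t = z + j - p - 1 \<ge> 0\<close>. Put \<open>s = u - z + t\<close>. Since \<open>\<beta>\<^sub>j\<close> is pseudo-Frobenius,
  \<open>\<beta>\<^sub>j + n = g\<^sub>s + (v - w) n - m\<^sub>0\<close> lies in \<open>H\<close>. If \<open>s < u - z\<close>, comparing a representation
  \<open>a m\<^sub>0 + g\<^sub>i + b n\<close> of this element with \<open>v n = \<mu> m\<^sub>0 + g\<^sub>z\<close> yields a multiple
  \<open>c n \<in> H'\<close> with \<open>0 < c < v\<close>, or \<open>g\<^sub>s \<notin> Ap(H, m\<^sub>0)\<close> with \<open>s < u\<close>.\<close>

section \<open>Closure properties of natural-number spans\<close>

lemma nat_span_zero: "0 \<in> nat_span S"
  unfolding nat_span_def by (intro CollectI exI[of _ "\<lambda>_. 0"]) simp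

lemma nat_span_add:
  assumes "x \<in> nat_span S" and "y \<in> nat_span S"
  shows "x + y \<in> nat_span S"
proof -
  obtain c c' :: "int \<Rightarrow> nat" where
    "x = (\<Sum>s\<in>S. int (c s) * s)" and "y = (\<Sum>s\<in>S. int (c' s) * s)"
    using assms unfolding nat_span_def by blast
  then have "x + y = (\<Sum>s\<in>S. int (c s + c' s) * s)"
    by (simp add: sum.distrib distrib_right)
  then show ?thesis
    unfolding nat_span_def by (intro CollectI exI[of _ "\<lambda>s. c s + c' s"]) simp
qed

lemma nat_span_mult:
  assumes "x \<in> nat_span S"
  shows "int k * x \<in> nat_span S"
  using assms by (induction k) (simp_all add: nat_span_zero nat_span_add distrib_right)

lemma nat_span_base:
  assumes "finite S" and "x \<in> S"
  shows "x \<in> nat_span S"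
proof -
  have "x = (\<Sum>s\<in>S. int (if s = x then 1 else 0) * s)"
    using assms by (simp add: sum.remove[of S x])
  then show ?thesis
    unfolding nat_span_def by (intro CollectI exI[of _ "\<lambda>s. if s = x then 1 else 0"]) simp
qed

lemma nat_span_induct [consumes 1, case_names zero base add]:
  assumes "x \<in> nat_span S"
    and zero: "P 0" and base: "\<And>s. s \<in> S \<Longrightarrow> P s" and add: "\<And>x y. P x \<Longrightarrow> P y \<Longrightarrow> P (x + y)"
  shows "P x"
proof -
  have mult: "P (int k * s)" if "s \<in> S" for k s
    by (induction k) (simp_all add: zero base that add distrib_right)
  have "P (\<Sum>s\<in>T. int (c s) * s)" if "T \<subseteq> S" for T and c :: "int \<Rightarrow> nat"
    using that by (induction T rule: infinite_finite_induct) (simp_all add: zero mult add)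
  then show ?thesis
    using assms(1) unfolding nat_span_def by blast
qed

lemma nat_span_mono:
  assumes "finite T" and "S \<subseteq> T"
  shows "nat_span S \<subseteq> nat_span T"
proof
  fix x assume "x \<in> nat_span S"
  then show "x \<in> nat_span T"
    by (induction rule: nat_span_induct)
      (use assms in \<open>auto intro: nat_span_zero nat_span_base nat_span_add\<close>)
qed

section \<open>Arithmetic of the elements \<open>g_elt\<close>\<close>

lemma quo_rmd_eqI:
  assumes "t = a * int p + int b" and "1 \<le> b" and "b \<le> p"
  shows "quo p t = a" and "rmd p t = b"
proof -
  have t: "t - 1 = (int b - 1) + a * int p" using assms by simp
  have "(t - 1) div int p = a" "(t - 1) mod int p = int b - 1"
    unfolding t using assms by (simp_all add: div_pos_pos_trivial mod_pos_pos_trivial)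
  then show "quo p t = a" and "rmd p t = b"
    unfolding quo_def rmd_def using assms by auto
qed

lemma quo_nonneg: "t \<ge> 1 \<Longrightarrow> quo p t \<ge> 0"
  unfolding quo_def by (cases "p = 0") (simp_all add: pos_imp_zdiv_nonneg_iff)

lemma arith_gen_0: "arith_gen d m0 0 = int m0"
  by (simp add: arith_gen_def)

lemma g_elt_eq:
  assumes "t = a * int p + int b" and "1 \<le> b" and "b \<le> p"
  shows "g_elt p d m0 t = a * arith_gen d m0 p + arith_gen d m0 b"
  unfolding g_elt_def using quo_rmd_eqI[OF assms] by simp

text \<open>Index 0 has quotient -1 and remainder \<open>p\<close>, so the two terms cancel.\<close>

lemma g_elt_0: "p \<ge> 1 \<Longrightarrow> g_elt p d m0 0 = 0"
  using g_elt_eq[of 0 "-1" p p] by simp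

text \<open>Two remainders in [1,p] either add up to a remainder, and m_a + m_b = m_0 + m_{a+b}
  leaves one m_0 over, or they carry into the quotient, and m_a + m_b = m_p + m_{a+b-p} leaves
  nothing.\<close>

lemma g_elt_add:
  assumes "p \<ge> 1"
  shows "g_elt p d m0 x + g_elt p d m0 y =
    g_elt p d m0 (x + y) + (if rmd p x + rmd p y \<le> p then int m0 else 0)"
proof -
  note x = quo_rmd[OF assms, of x] and y = quo_rmd[OF assms, of y]
  show ?thesis
  proof (cases "rmd p x + rmd p y \<le> p")
    case True
    have "g_elt p d m0 (x + y) =
        (quo p x + quo p y) * arith_gen d m0 p + arith_gen d m0 (rmd p x + rmd p y)"
      using x y True by (intro g_elt_eq) (auto simp: distrib_right)
    with True show ?thesis
      by (simp add: g_elt_def arith_gen_def algebra_simps)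
  next
    case False
    have "g_elt p d m0 (x + y) =
        (quo p x + quo p y + 1) * arith_gen d m0 p + arith_gen d m0 (rmd p x + rmd p y - p)"
      using x y False by (intro g_elt_eq) (auto simp: distrib_right of_nat_diff)
    with False show ?thesis
      by (simp add: g_elt_def arith_gen_def of_nat_diff algebra_simps)
  qed
qed

lemma g_elt_add_cases:
  assumes "p \<ge> 1"
  obtains a :: nat where "a \<le> 1"
    and "g_elt p d m0 x + g_elt p d m0 y = g_elt p d m0 (x + y) + int a * int m0"
  using g_elt_add[OF assms, of d m0 x y]
  by (cases "rmd p x + rmd p y \<le> p") (auto intro: that[of 0] that[of 1])

lemma g_elt_gt:
  assumes "p \<ge> 1" and "d \<ge> 1" and "t \<ge> 1"
  shows "g_elt p d m0 t > int m0"
proof -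
  have "quo p t * arith_gen d m0 p \<ge> 0"
    using quo_nonneg[OF assms(3)] by (simp add: arith_gen_def)
  moreover have "arith_gen d m0 (rmd p t) > int m0"
    using quo_rmd(2)[OF assms(1), of t] assms(2) by (auto simp: arith_gen_def)
  ultimately show ?thesis
    unfolding g_elt_def by linarith
qed

section \<open>Normal forms in the two semigroups\<close>

lemma semigroup_H'_I:
  assumes "p \<ge> 1" and "a \<ge> 0" and "i \<ge> 0"
  shows "a * int m0 + g_elt p d m0 i \<in> semigroup_H' p d m0"
proof -
  have gen: "arith_gen d m0 k \<in> semigroup_H' p d m0" if "k \<le> p" for k
    unfolding semigroup_H'_def using that by (intro nat_span_base) auto
  have mult: "b * arith_gen d m0 k \<in> semigroup_H' p d m0" if "k \<le> p" "b \<ge> 0" for k b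
    using gen[OF that(1)] nat_span_mult[of _ _ "nat b"] that(2) unfolding semigroup_H'_def by simp
  have "g_elt p d m0 i \<in> semigroup_H' p d m0"
  \<comment> \<open>Index 0 is separate because its quotient -1 is no admissible coefficient of
    m_p.\<close>
  proof (cases "i = 0")
    case True
    then show ?thesis using assms(1) by (simp add: g_elt_0 semigroup_H'_def nat_span_zero)
  next
    case False
    then have "quo p i \<ge> 0" using assms(3) by (intro quo_nonneg) simp
    then show ?thesis
      unfolding g_elt_def using mult[of p] gen[of "rmd p i"] quo_rmd(2)[OF assms(1), of i]
      unfolding semigroup_H'_def by (auto intro: nat_span_add)
  qed
  moreover have "a * int m0 \<in> semigroup_H' p d m0"
    using mult[of 0 a] assms(2) by (simp add: arith_gen_0)
  ultimately show ?thesis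
    unfolding semigroup_H'_def by (rule nat_span_add[rotated])
qed

lemma semigroup_H_n: "int n \<in> semigroup_H p d m0 n"
  unfolding semigroup_H_def gens_def by (intro nat_span_base) auto

lemma semigroup_H_I:
  assumes "p \<ge> 1" and "a \<ge> 0" and "i \<ge> 0" and "b \<ge> 0"
  shows "a * int m0 + g_elt p d m0 i + b * int n \<in> semigroup_H p d m0 n"
proof -
  have "semigroup_H' p d m0 \<subseteq> semigroup_H p d m0 n"
    unfolding semigroup_H_def semigroup_H'_def gens_def by (intro nat_span_mono) auto
  then have "a * int m0 + g_elt p d m0 i \<in> semigroup_H p d m0 n"
    using semigroup_H'_I[OF assms(1-3)] by blast
  moreover have "b * int n \<in> semigroup_H p d m0 n"
    using semigroup_H_n[of n p d m0] nat_span_mult[of _ _ "nat b"] assms(4)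
    unfolding semigroup_H_def by simp
  ultimately show ?thesis
    unfolding semigroup_H_def by (rule nat_span_add)
qed

text \<open>By the addition rule, the generators m_1, ..., m_p in any sum collapse into a single
  \<open>g_elt\<close>; each surplus is a nonnegative multiple of m_0.\<close>

lemma semigroup_H_E:
  assumes "p \<ge> 1" and "h \<in> semigroup_H p d m0 n"
  obtains a i b :: nat where "h = int a * int m0 + g_elt p d m0 (int i) + int b * int n"
proof -
  have "\<exists>a i b :: nat. h = int a * int m0 + g_elt p d m0 (int i) + int b * int n"
    using assms(2) unfolding semigroup_H_def
  proof (induction rule: nat_span_induct)
    case zero
    have "0 = int 0 * int m0 + g_elt p d m0 (int 0) + int 0 * int n"
      using assms(1) by (simp add: g_elt_0)
    then show ?case by blast
  next
    case (base s)
    then consider "s = int n" | k where "k \<le> p" "s = arith_gen d m0 k"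
      unfolding gens_def by auto
    then show ?case
    proof cases
      case 1
      then have "s = int 0 * int m0 + g_elt p d m0 (int 0) + int 1 * int n"
        using assms(1) by (simp add: g_elt_0)
      then show ?thesis by blast
    next
      case 2
      show ?thesis
      \<comment> \<open>0 is not a remainder, so m_0 enters through the coefficient \<open>a\<close>
        instead of \<open>g_elt\<close>.\<close>
      proof (cases "k = 0")
        case True
        then have "s = int 1 * int m0 + g_elt p d m0 (int 0) + int 0 * int n"
          using 2 assms(1) by (simp add: g_elt_0 arith_gen_0)
        then show ?thesis by blast
      next
        case False
        then have "s = int 0 * int m0 + g_elt p d m0 (int k) + int 0 * int n"
          using 2 g_elt_eq[of "int k" 0 p k] by simp
        then show ?thesis by blast
      qed
    qed
  next
    case (add x y)
    then obtain a i b a' i' b' :: nat where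
      x: "x = int a * int m0 + g_elt p d m0 (int i) + int b * int n" and
      y: "y = int a' * int m0 + g_elt p d m0 (int i') + int b' * int n"
      by blast
    obtain c :: nat where
      "g_elt p d m0 (int i) + g_elt p d m0 (int i') = g_elt p d m0 (int i + int i') + int c * int m0"
      by (rule g_elt_add_cases[OF assms(1)])
    then have "x + y = int (a + a' + c) * int m0 + g_elt p d m0 (int (i + i')) + int (b + b') * int n"
      unfolding x y by (simp add: algebra_simps)
    then show ?case by blast
  qed
  then show ?thesis using that by blast
qed

section \<open>Minimality of \<open>u\<close> and \<open>v\<close>, and the region left of
  \<open>W\<close>\<close>

lemma g_elt_diff_notin_H:
  assumes "i < u_idx p d m0 n"
  shows "g_elt p d m0 (int i) - int m0 \<notin> semigroup_H p d m0 n"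
  using not_less_Least[OF assms[unfolded u_idx_def]] unfolding apery_def by blast

lemma mult_n_notin_H':
  assumes "1 \<le> c" and "c < v_idx p d m0 n"
  shows "int c * int n \<notin> semigroup_H' p d m0"
  using not_less_Least[OF assms(2)[unfolded v_idx_def]] assms(1) by blast

text \<open>A part of the Patil--Singh description of the Apery set: \<open>g\<^sub>s + (v - w) n\<close> belongs to it
  whenever \<open>(s, v - w)\<close> lies to the left of the rectangle \<open>W\<close>.\<close>

lemma left_of_W_notin_H:
  assumes p: "p \<ge> 1" and u: "u = u_idx p d m0 n" and v: "v = v_idx p d m0 n"
    and vn: "int v * int n = int mu * int m0 + g_elt p d m0 (int z)"
    and w: "1 \<le> w" "w < v" and s: "s + z < u"
  shows "g_elt p d m0 (int s) + (int v - int w) * int n - int m0 \<notin> semigroup_H p d m0 n"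
proof
  let ?g = "g_elt p d m0"
  assume "?g (int s) + (int v - int w) * int n - int m0 \<in> semigroup_H p d m0 n"
  then obtain a i b :: nat where
    rep: "?g (int s) + (int v - int w) * int n - int m0
      = int a * int m0 + ?g (int i) + int b * int n"
    by (rule semigroup_H_E[OF p])
  show False
  \<comment> \<open>If the representation has at least v - w copies of \<open>n\<close>, cancelling
    them puts g_s - m_0 into \<open>H\<close>, although s < u. Otherwise c > 0 copies remain on the
    left, and c < v because w \<ge> 1.\<close>
  proof (cases "b < v - w")
    case False
    have "?g (int s) - int m0 = int a * int m0 + ?g (int i) + (int b - (int v - int w)) * int n"
      using rep by (simp add: algebra_simps)
    also have "\<dots> \<in> semigroup_H p d m0 n"
      using False w by (intro semigroup_H_I[OF p]) auto
    finally show False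
      using g_elt_diff_notin_H[of s p d m0 n] s u by simp
  next
    case True
    define c where "c = v - w - b"
    have c: "1 \<le> c" "c < v" "v - c \<ge> 1" "v - c < v"
      using True w unfolding c_def by auto
    have cint: "int c = int v - int w - int b" using True unfolding c_def by simp
    have eq: "?g (int s) + int c * int n = (int a + 1) * int m0 + ?g (int i)"
      using rep unfolding cint by (simp add: algebra_simps)
    show False
    proof (cases "s < i")
      case True
      \<comment> \<open>The bound on \<open>k\<close> matters: it keeps the coefficient a + 1 - k
        nonnegative.\<close>
      obtain k :: nat where k: "k \<le> 1"
        "?g (int s) + ?g (int i - int s) = ?g (int s + (int i - int s)) + int k * int m0"
        by (rule g_elt_add_cases[OF p])
      have "int c * int n = (int a + 1 - int k) * int m0 + ?g (int i - int s)"
        using eq k(2) by (simp add: algebra_simps)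
      also have "\<dots> \<in> semigroup_H' p d m0"
        using True k(1) by (intro semigroup_H'_I[OF p]) auto
      finally show False
        using mult_n_notin_H'[of c p d m0 n] c v by simp
    next
      case False
      define x where "x = s - i"
      have x: "int s = int i + int x" "x + z < u" using False s unfolding x_def by auto
      obtain k :: nat where k: "?g (int i) + ?g (int x) = ?g (int i + int x) + int k * int m0"
        by (rule g_elt_add_cases[OF p])
      obtain l :: nat where l: "?g (int x) + ?g (int z) = ?g (int x + int z) + int l * int m0"
        by (rule g_elt_add_cases[OF p])
      \<comment> \<open>Eliminating g_s, g_i and g_z gives (v - c) n = N m_0 + g_{x+z}. Either sign
        of \<open>N\<close> is impossible: N \<ge> 0 contradicts the minimality of \<open>v\<close>,
        and N < 0 that of \<open>u\<close>, since x + z < u.\<close>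
      define N where "N = int mu + int l - (int a + 1 + int k)"
      have gxz: "?g (int (x + z)) = (- N) * int m0 + int (v - c) * int n"
      proof -
        have "int (v - c) = int v - int c" using c by simp
        then show ?thesis
          using eq k l vn unfolding N_def x(1) by (simp add: algebra_simps)
      qed
      have "N \<ge> 0"
      proof (rule ccontr)
        assume "\<not> N \<ge> 0"
        have "?g (int (x + z)) - int m0 = (- N - 1) * int m0 + ?g 0 + int (v - c) * int n"
          using gxz g_elt_0[OF p] by (simp add: algebra_simps)
        also have "\<dots> \<in> semigroup_H p d m0 n"
          using \<open>\<not> N \<ge> 0\<close> by (intro semigroup_H_I[OF p]) auto
        finally show False
          using g_elt_diff_notin_H[of "x + z" p d m0 n] x(2) u by blast
      qed
      have "int (v - c) * int n = N * int m0 + ?g (int (x + z))"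
        using gxz by (simp add: algebra_simps)
      also have "\<dots> \<in> semigroup_H' p d m0"
        using \<open>N \<ge> 0\<close> by (intro semigroup_H'_I[OF p]) auto
      finally show False
        using mult_n_notin_H'[of "v - c" p d m0 n] c v by blast
    qed
  qed
qed

section \<open>Matrices with prescribed rows\<close>

definition gen_vec :: "nat \<Rightarrow> nat \<Rightarrow> nat \<Rightarrow> nat \<Rightarrow> int vec" where
  "gen_vec p d m0 n = vec (p + 2) (\<lambda>i. if i \<le> p then arith_gen d m0 i else int n)"

lemma gen_vec_carrier [simp]: "gen_vec p d m0 n \<in> carrier_vec (p + 2)"
  by (simp add: gen_vec_def)

lemma gen_vec_index: "i \<le> p \<Longrightarrow> gen_vec p d m0 n $ i = arith_gen d m0 i"
  "gen_vec p d m0 n $ (p + 1) = int n"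
  by (simp_all add: gen_vec_def)

text \<open>Expressing row sums as scalar products lets rows that are combinations of unit vectors
  be evaluated by linearity.\<close>

lemma RF_matrix_of_rows:
  fixes R :: "nat \<Rightarrow> int vec"
  assumes carrier: "\<And>i. i < p + 2 \<Longrightarrow> R i \<in> carrier_vec (p + 2)"
    and diag: "\<And>i. i < p + 2 \<Longrightarrow> R i $ i = - 1"
    and off: "\<And>i k. i < p + 2 \<Longrightarrow> k < p + 2 \<Longrightarrow> i \<noteq> k \<Longrightarrow> R i $ k \<ge> 0"
    and sum: "\<And>i. i < p + 2 \<Longrightarrow> R i \<bullet> gen_vec p d m0 n = f"
  shows "\<exists>A. RF_matrix p d m0 n f A \<and> (\<forall>i < p + 2. row A i = R i)"
proof -
  define A where "A = mat (p + 2) (p + 2) (\<lambda>(i, k). R i $ k)"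
  have "(\<Sum>k = 0..p. A $$ (i, k) * arith_gen d m0 k) + A $$ (i, p + 1) * int n = f"
    if i: "i < p + 2" for i
  proof -
    have "R i \<bullet> gen_vec p d m0 n = (\<Sum>k = 0..<Suc (Suc p). R i $ k * gen_vec p d m0 n $ k)"
      by (simp add: scalar_prod_def gen_vec_def)
    also have "\<dots> = (\<Sum>k = 0..p. R i $ k * gen_vec p d m0 n $ k) + R i $ (p + 1) * int n"
      by (simp add: gen_vec_def atLeastLessThanSuc_atLeastAtMost)
    also have "\<dots> = (\<Sum>k = 0..p. A $$ (i, k) * arith_gen d m0 k) + A $$ (i, p + 1) * int n"
      using i by (auto simp: A_def gen_vec_index intro!: sum.cong)
    finally show ?thesis using sum[OF i] by simp
  qed
  then have "RF_matrix p d m0 n f A"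
    unfolding RF_matrix_def using diag off by (auto simp: A_def)
  moreover have "row A i = R i" if "i < p + 2" for i
    using that carrier[OF that] by (auto simp: A_def intro!: eq_vecI)
  ultimately show ?thesis by blast
qed

section \<open>Construction of the \<open>RF_matrix\<close>\<close>

theorem proposition4p12:
  fixes p d m0 n z w lam mu u v r r' j e :: nat
    and q nu :: int
    and E :: "nat \<Rightarrow> int vec"
  assumes "almost_arithmetic p d m0 n"
    and "patil_singh_data p d m0 n z w lam mu"
    and "u = u_idx p d m0 n" and "v = v_idx p d m0 n"
    and "nu = nu_coeff p d m0 n z lam mu"
    and "q = quo p (int u)" and "r = rmd p (int u)"
    and "r' = rmd p (int u - int z)"
    and "E = (\<lambda>i. unit_vec (p + 2) i)"
    and "W_set p d m0 n z w \<noteq> {}"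
    and "r \<ge> 2"
    and "j \<in> {p - r + 2..p}"
    and "beta p d m0 n w j \<in> PF2 p d m0 n w"
    and "e \<in> {1..p - 1}" and "r + j + e = 2 * p + 1"
  shows "\<exists>A. RF_matrix p d m0 n (beta p d m0 n w j) A \<and>
    row A 0 = - E 0 + q \<cdot>\<^sub>v E p + (int v - int w - 1) \<cdot>\<^sub>v E (p + 1) + E (p - e) \<and>
    (\<forall>k \<in> {1..e}.
      row A k = - E k + q \<cdot>\<^sub>v E p + (int v - int w - 1) \<cdot>\<^sub>v E (p + 1) + E (p - e + k)) \<and>
    (\<forall>k \<in> {e + 1..p}.
      row A k = (int lam - 1) \<cdot>\<^sub>v E 0 - E k + (int v - 1) \<cdot>\<^sub>v E (p + 1) + E (j + k - p - 1)) \<and>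
    (let t = int z + int j - int p - 1; eps = (if r' + rmd p t \<le> p then 2 else 1) in
      row A (p + 1) = (nu - eps) \<cdot>\<^sub>v E 0 + quo p t \<cdot>\<^sub>v E p - E (p + 1) + E (rmd p t))"
proof -
  let ?g = "g_elt p d m0" and ?m = "arith_gen d m0" and ?G = "gen_vec p d m0 n"
  let ?b = "beta p d m0 n w j"
  have p: "p \<ge> 1" and d: "d \<ge> 1" and n: "n \<ge> 1"
    using assms(1) by (auto simp: almost_arithmetic_def)
  have ps: "z < u" "w < v" "lam \<ge> 1"
      "?g (int u) = int lam * int m0 + int w * int n"
      "int v * int n = int mu * int m0 + ?g (int z)"
      "?g (int u - int z) + (int v - int w) * int n = nu * int m0"
    using assms(2-5) unfolding patil_singh_data_def Let_def by auto
  \<comment> \<open>For w = 0 the second factor of \<open>W_set\<close> would be the empty interval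
    from v to v - 1.\<close>
  have w: "w \<ge> 1"
    using assms(3,4,10) unfolding W_set_def Let_def by (cases w) auto
  have u: "int u = q * int p + int r" and r: "r \<le> p"
    using quo_rmd[OF p, of "int u"] assms(6,7) by auto
  have q: "q \<ge> 0" using ps(1) assms(6) by (simp add: quo_nonneg)
  have e: "1 \<le> e" "e < p" using assms(14) p by auto
  have j: "j \<le> p" using assms(12) by simp
  define t where "t = int z + int j - int p - 1"
  \<comment> \<open>One more than the m_0-coefficient in the addition rule for g_{u-z} + g_t; the
    extra unit is the summand -m_0 of \<open>beta\<close>.\<close>
  define eps :: int where "eps = (if r' + rmd p t \<le> p then 2 else 1)"
  \<comment> \<open>The relation r + j + e = 2p + 1 says r + j - p - 1 = p - e, a valid remainder
    since 1 \<le> e < p.\<close>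
  have s: "int u - int z + t = q * int p + int (p - e)"
    using assms(15) e unfolding t_def u by (simp add: of_nat_diff algebra_simps)
  have "(q - 1) * int p + int r + int j - 1 = int u - int z + t"
    unfolding t_def u by (simp add: algebra_simps)
  then have beta_g: "?b = ?g (int u - int z + t) + (int v - int w - 1) * int n - int m0"
    unfolding beta_def Let_def using assms(3,4,6,7) by simp
  have gs: "?g (int u - int z + t) = q * ?m p + ?m (p - e)"
    using s e by (intro g_elt_eq) auto
  have beta_m: "?b = q * ?m p + ?m (p - e) + (int v - int w - 1) * int n - int m0"
    unfolding beta_g gs ..
  have "?b + int n \<in> semigroup_H p d m0 n"
    using assms(13) semigroup_H_n[of n p d m0] n
    unfolding PF2_def pseudo_frobenius_def Let_def by auto
  then have in_H: "?g (int u - int z + t) + (int v - int w) * int n - int m0 \<in> semigroup_H p d m0 n"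
    unfolding beta_g by (simp add: algebra_simps)
  have t: "t \<ge> 0"
  proof (rule ccontr)
    assume "\<not> t \<ge> 0"
    define s where "s = nat (int u - int z + t)"
    have "int u - int z + t \<ge> 0" unfolding s using q by simp
    then have "int s = int u - int z + t" and "s + z < u"
      unfolding s_def using \<open>\<not> t \<ge> 0\<close> by auto
    then show False
      using left_of_W_notin_H[OF p assms(3,4) ps(5) w ps(2)] in_H by metis
  qed
  have rt: "1 \<le> rmd p t" "rmd p t \<le> p" using quo_rmd(2)[OF p, of t] by auto
  \<comment> \<open>Needed because \<open>eps\<close> can be 2. Since u - z \<ge> 1, g_{u-z} already
    exceeds m_0.\<close>
  have nu: "nu \<ge> 2"
  proof (rule ccontr)
    assume "\<not> nu \<ge> 2"
    then have "nu * int m0 \<le> 1 * int m0" by (intro mult_right_mono) auto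
    moreover have "?g (int u - int z) > int m0" using ps(1) by (intro g_elt_gt p d) simp
    moreover have "(int v - int w) * int n \<ge> 0" using ps(2) by simp
    ultimately show False using ps(6) by linarith
  qed
  \<comment> \<open>For t = 0 the coefficient of \<open>E p\<close> in the last row is -1, but
    \<open>E (rmd p t)\<close> is then \<open>E p\<close> and cancels it.\<close>
  have qt: "quo p t \<ge> 0 \<or> quo p t = - 1 \<and> rmd p t = p"
  proof (cases "t = 0")
    case True
    then show ?thesis using quo_rmd_eqI[of t "- 1" p p] p by simp
  next
    case False
    then show ?thesis using t quo_nonneg[of t p] by simp
  qed
  define R where "R i =
    (if i = 0 then - E 0 + q \<cdot>\<^sub>v E p + (int v - int w - 1) \<cdot>\<^sub>v E (p + 1) + E (p - e)
     else if i \<le> e then - E i + q \<cdot>\<^sub>v E p + (int v - int w - 1) \<cdot>\<^sub>v E (p + 1) + E (p - e + i)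
     else if i \<le> p then (int lam - 1) \<cdot>\<^sub>v E 0 - E i + (int v - 1) \<cdot>\<^sub>v E (p + 1) + E (j + i - p - 1)
     else (nu - eps) \<cdot>\<^sub>v E 0 + quo p t \<cdot>\<^sub>v E p - E (p + 1) + E (rmd p t))" for i
  have E: "E i = unit_vec (p + 2) i" for i using assms(9) by simp
  have "\<exists>A. RF_matrix p d m0 n ?b A \<and> (\<forall>i < p + 2. row A i = R i)"
  proof (rule RF_matrix_of_rows)
    fix i assume i: "i < p + 2"
    have idx: "E l $ k = (if k = l then 1 else 0)" if "k < p + 2" for l k
      using that unfolding E unit_vec_def by simp
    have dim: "dim_vec (E l) = p + 2" for l unfolding E by simp
    consider "i = 0" | "1 \<le> i" "i \<le> e" | "e < i" "i \<le> p" | "i = p + 1"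
      using i by linarith
    note rows = this
    show "R i \<in> carrier_vec (p + 2)" unfolding R_def E by simp
    \<comment> \<open>No other unit vector of row \<open>i\<close> meets the diagonal: in particular
      i \<le> e < p and p - e + i > i in the second block, and j + i - p - 1 < i in the
      third.\<close>
    from rows show "R i $ i = - 1"
      by cases (use e j rt in \<open>auto simp: R_def idx dim\<close>)
    show "R i $ k \<ge> 0" if "k < p + 2" "i \<noteq> k" for k
      using rows
    proof cases
      case 4
      then have "R i $ k = (nu - eps) * (if k = 0 then 1 else 0)
          + (quo p t * (if k = p then 1 else 0) + (if k = rmd p t then 1 else 0))"
        using that e by (simp add: R_def idx dim)
      moreover have "quo p t * (if k = p then 1 else 0) + (if k = rmd p t then 1 else 0) \<ge> 0"
        using qt by auto
      ultimately show ?thesis using nu unfolding eps_def by simp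
    qed (use that e q ps(2,3) in \<open>simp_all add: R_def idx dim\<close>)
    have dot: "E k \<bullet> ?G = (if k \<le> p then ?m k else int n)" if "k < p + 2" for k
      using that unfolding E by (simp add: gen_vec_def)
    have dimG: "dim_vec ?G = p + 2" by (simp add: gen_vec_def)
    note lin = add_scalar_prod_distrib[of _ "p + 2"] minus_scalar_prod_distrib[of _ "p + 2"]
      smult_scalar_prod_distrib[of _ "p + 2"] scalar_prod_uminus_left
    have carrier: "E k \<in> carrier_vec (p + 2)" for k unfolding E by simp
    from rows show "R i \<bullet> ?G = ?b"
    proof cases
      case 1
      then show ?thesis
        using e by (simp add: R_def lin carrier dim dimG dot beta_m arith_gen_0 del: add_2_eq_Suc')
    next
      case 2
      then have le: "p - e + i \<le> p" and pe: "int (p - e + i) = int (p - e) + int i"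
        using e by auto
      have "R i \<bullet> ?G = - ?m i + q * ?m p + (int v - int w - 1) * int n + ?m (p - e + i)"
        using 2 e le dot[of "p - e + i"] by (simp add: R_def lin carrier dim dimG dot del: add_2_eq_Suc')
      moreover have "?m (p - e + i) - ?m i = ?m (p - e) - int m0"
        unfolding arith_gen_def pe by (simp add: algebra_simps)
      ultimately show ?thesis unfolding beta_m by simp
    next
      case 3
      \<comment> \<open>The subtraction is not truncated: i > e gives j + i \<ge> 2p + 2 - r \<ge> p
        + 2.\<close>
      have jk: "int (j + i - p - 1) = int j + int i - int p - 1" and jk': "j + i - p - 1 \<le> p"
        using 3 assms(15) r j by auto
      have "?g (int u) = q * ?m p + ?m r" using u r assms(11) by (intro g_elt_eq) auto
      \<comment> \<open>The third block arises by trading \<open>lam\<close> copies of m_0 and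
        \<open>w\<close> of \<open>n\<close> for g_u.\<close>
      then have "(int lam - 1) * int m0 = q * ?m p + ?m r - int w * int n - int m0"
        using ps(4) by (simp add: algebra_simps)
      moreover have "?m (j + i - p - 1) - ?m i + ?m r = ?m (p - e)"
      proof -
        have pe: "int (p - e) = int j + int r - int p - 1"
          using assms(15) e by linarith
        show ?thesis unfolding arith_gen_def pe jk by (simp add: algebra_simps)
      qed
      moreover have "R i \<bullet> ?G = (int lam - 1) * int m0 - ?m i + (int v - 1) * int n + ?m (j + i - p - 1)"
        using 3 jk' by (simp add: R_def lin carrier dim dimG dot arith_gen_0 del: add_2_eq_Suc')
      ultimately show ?thesis unfolding beta_m by (simp add: algebra_simps)
    next
      case 4
      have "R i \<bullet> ?G = (nu - eps) * int m0 + ?g t - int n"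
        using 4 e rt by (simp add: R_def lin carrier dim dimG dot arith_gen_0 g_elt_def del: add_2_eq_Suc')
      \<comment> \<open>After nu m_0 is replaced by g_{u-z} + (v - w) n, adding g_t restores the
        index of \<open>beta\<close>.\<close>
      moreover have "?g (int u - int z) + ?g t = ?g (int u - int z + t) + (eps - 1) * int m0"
        using g_elt_add[OF p, of d m0 "int u - int z" t] assms(8) unfolding eps_def by simp
      ultimately show ?thesis
        using ps(6) unfolding beta_g by (simp add: algebra_simps)
    qed
  qed
  then obtain A where "RF_matrix p d m0 n ?b A" and row: "\<And>i. i < p + 2 \<Longrightarrow> row A i = R i"
    by blast
  moreover have "row A 0 = R 0" and "row A (p + 1) = R (p + 1)"
    and "\<forall>k \<in> {1..e}. row A k = R k" and "\<forall>k \<in> {e + 1..p}. row A k = R k"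
    using row e by auto
  ultimately show ?thesis
    using e unfolding R_def t_def eps_def Let_def by (intro exI[of _ A]) auto
qed

end
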